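(* Let $D$ be a minimal strong digraph, let $C_q$ be a directed cycle of length $q\ge 2$ contained in $D$, let $D'$ be the digraph obtained from $D$ by deleting all arcs of $C_q$, and let $H$ be the digraph obtained from $D'$ by contracting each strong component of $D'$ to a single vertex. Then the number of linear vertices of $H$ is greater than or equal to the number of pseudominimal vertices of $H$, and also greater than or equal to the number of pseudomaximal vertices of $H$.
   Context: An arc $uv$ of a digraph is transitive if there is another directed $uv$-path not using the arc $uv$. A minimal strong digraph is a strongly connected digraph with no transitive arcs. A strong component (SC) is a maximal strongly connected subdigraph. The digraph $H$ (called the Hasse diagram associated to $(D,C_q)$) has one vertex per SC of $D'$ and an arc from the vertex of $S_1$ to the vertex of $S_2$ whenever $D'$ has an arc from a vertex of $S_1$ to a vertex of $S_2$ ($S_1\ne S_2$); it is acyclic without transitive arcs. A strong component of $D'$ is anchored if it contains at least one vertex of $C_q$. A vertex of $H$ is pseudominimal if it corresponds to an anchored SC and has outdegree greater than $0$ in $H$; it is pseudomaximal if it corresponds to an anchored SC and has indegree greater than $0$ in $H$. A vertex of $H$ is linear if its indegree and outdegree in $H$ are both $1$. *)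

theory Defs
  imports "Graph_Theory.Graph_Theory"
begin

definition transitive_arc :: "('a,'b) pre_digraph \<Rightarrow> 'b \<Rightarrow> bool" where
  "transitive_arc G e \<longleftrightarrow> e \<in> arcs G \<and>
     (\<exists>p. pre_digraph.apath G (tail G e) p (head G e) \<and> e \<notin> set p)"

text \<open>The locale \<^locale>\<open>digraph\<close> requires finiteness and excludes loops and parallel arcs.\<close>

definition minimal_strong_digraph :: "('a,'b) pre_digraph \<Rightarrow> bool" where
  "minimal_strong_digraph G \<longleftrightarrow> digraph G \<and> strongly_connected G \<and>
     (\<forall>e \<in> arcs G. \<not> transitive_arc G e)"

definition del_arcs :: "('a,'b) pre_digraph \<Rightarrow> 'b set \<Rightarrow> ('a,'b) pre_digraph" where
  "del_arcs G A = \<lparr> verts = verts G, arcs = arcs G - A, tail = tail G, head = head G \<rparr>"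

text \<open>Arcs of the contraction are pairs of distinct strong components, so it has no loops and
  no parallel arcs.\<close>

definition scc_contraction ::
  "('a,'b) pre_digraph \<Rightarrow>
    (('a,'b) pre_digraph, ('a,'b) pre_digraph \<times> ('a,'b) pre_digraph) pre_digraph" where
  "scc_contraction G =
    \<lparr> verts = pre_digraph.sccs G,
      arcs = {(S1, S2). S1 \<in> pre_digraph.sccs G \<and> S2 \<in> pre_digraph.sccs G \<and> S1 \<noteq> S2 \<and>
                (\<exists>e \<in> arcs G. tail G e \<in> verts S1 \<and> head G e \<in> verts S2)},
      tail = fst,
      head = snd \<rparr>"

definition hasse_diagram ::
  "('a,'b) pre_digraph \<Rightarrow> 'b awalk \<Rightarrow>
    (('a,'b) pre_digraph, ('a,'b) pre_digraph \<times> ('a,'b) pre_digraph) pre_digraph" where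
  "hasse_diagram D c = scc_contraction (del_arcs D (set c))"

definition cycle_verts :: "('a,'b) pre_digraph \<Rightarrow> 'b awalk \<Rightarrow> 'a set" where
  "cycle_verts D c = tail D ` set c \<union> head D ` set c"

definition anchored :: "('a,'b) pre_digraph \<Rightarrow> 'b awalk \<Rightarrow> ('a,'b) pre_digraph \<Rightarrow> bool" where
  "anchored D c S \<longleftrightarrow> S \<in> pre_digraph.sccs (del_arcs D (set c)) \<and> verts S \<inter> cycle_verts D c \<noteq> {}"

definition pseudominimal :: "('a,'b) pre_digraph \<Rightarrow> 'b awalk \<Rightarrow> ('a,'b) pre_digraph \<Rightarrow> bool" where
  "pseudominimal D c S \<longleftrightarrow> anchored D c S \<and> out_degree (hasse_diagram D c) S > 0"

definition pseudomaximal :: "('a,'b) pre_digraph \<Rightarrow> 'b awalk \<Rightarrow> ('a,'b) pre_digraph \<Rightarrow> bool" where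
  "pseudomaximal D c S \<longleftrightarrow> anchored D c S \<and> in_degree (hasse_diagram D c) S > 0"

definition linear_vertex :: "('a,'b) pre_digraph \<Rightarrow> 'a \<Rightarrow> bool" where
  "linear_vertex G v \<longleftrightarrow> in_degree G v = 1 \<and> out_degree G v = 1"

end

theory Submission
  imports Defs
begin

text \<open>If an arc \<open>u \<rightarrow> x\<close> of \<open>H\<close> had another way from \<open>u\<close> to the cycle and another way from the
  cycle to \<open>x\<close>, it would come from a transitive arc of \<open>D\<close>. Since every vertex of \<open>H\<close> reaches, and
  is reached from, an anchored one, it follows that \<open>x\<close> is not anchored and has indegree \<open>1\<close>
  whenever \<open>u\<close> is anchored or has outdegree at least \<open>2\<close>. So from a pseudominimal vertex one can
  walk along non-anchored vertices of indegree \<open>1\<close> until the outdegree drops to \<open>1\<close>, that is, to a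
  linear vertex. Walking backwards recovers the pseudominimal vertex, so distinct pseudominimal
  vertices yield distinct linear vertices. The hypotheses are invariant under reversing arcs, which
  gives the pseudomaximal case.\<close>

section \<open>Linear vertices of acyclic relations\<close>

text \<open>The first arc leaves \<open>A\<close>; every later arc leaves a branching vertex, with
  \<open>z\<close> as the second out-neighbour. So the tail of the last arc is in \<open>A\<close>
  or branches, whatever the endpoint does.\<close>

inductive branch_path :: "('v \<times> 'v) set \<Rightarrow> 'v set \<Rightarrow> 'v \<Rightarrow> 'v \<Rightarrow> bool" for E A where
  start: "v \<in> A \<Longrightarrow> (v, x) \<in> E \<Longrightarrow> branch_path E A v x"
| step: "branch_path E A v y \<Longrightarrow> (y, x) \<in> E \<Longrightarrow> (y, z) \<in> E \<Longrightarrow> z \<noteq> x \<Longrightarrow> branch_path E A v x"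

text \<open>Membership in \<open>A\<close> counts as branching at either end, since an anchored
  component already meets the cycle. Reversing the arcs swaps the two conjuncts.\<close>

definition branch_free :: "('v \<times> 'v) set \<Rightarrow> 'v set \<Rightarrow> bool" where
  "branch_free E A \<longleftrightarrow> (\<forall>u x. (u, x) \<in> E \<longrightarrow>
     \<not> ((u \<in> A \<or> (\<exists>y. y \<noteq> x \<and> (u, y) \<in> E)) \<and> (x \<in> A \<or> (\<exists>y. y \<noteq> u \<and> (y, x) \<in> E))))"

definition linear_points :: "('v \<times> 'v) set \<Rightarrow> 'v set" where
  "linear_points E = {x. (\<exists>!y. (y, x) \<in> E) \<and> (\<exists>!y. (x, y) \<in> E)}"

lemma branch_free_converse: "branch_free E A \<Longrightarrow> branch_free (E\<inverse>) A"
  unfolding branch_free_def by blast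

lemma linear_points_converse: "linear_points (E\<inverse>) = linear_points E"
  unfolding linear_points_def by blast

text \<open>Whichever rule came last, the last arc has a tail that is in \<open>A\<close> or
  branches, so \<open>branch_free\<close> rules out both alternatives at its head.\<close>

lemma branch_path_endpoint:
  assumes "branch_path E A v x" "branch_free E A"
  shows "x \<notin> A \<and> (\<exists>!y. (y, x) \<in> E)"
proof -
  obtain u where "(u, x) \<in> E" "u \<in> A \<or> (\<exists>y. y \<noteq> x \<and> (u, y) \<in> E)"
    using assms(1) by cases auto
  then show ?thesis using assms(2) unfolding branch_free_def by metis
qed

text \<open>Endpoints have a single in-neighbour, so the path can be retraced. Membership in
  \<open>A\<close> shows where to stop: the start lies in \<open>A\<close>, all later vertices lie
  outside.\<close>

lemma branch_path_start_unique:
  assumes "branch_path E A v x" "branch_path E A w x" "branch_free E A"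
  shows "v = w"
  using assms
proof (induction arbitrary: w)
  case (start v x)
  have x: "\<exists>!y. (y, x) \<in> E"
    using branch_path_endpoint[OF start.prems] by blast
  from start.prems(1) show ?case
  proof cases
    \<comment> \<open>Here \<open>y\<close> would equal \<open>v\<close>, but \<open>v\<close> is in
      \<open>A\<close>, while \<open>y\<close> ends a path and is therefore outside
      \<open>A\<close>.\<close>
    case (step y z)
    then show ?thesis using x start branch_path_endpoint[OF step(1) start.prems(2)] by blast
  qed (use x start in blast)
next
  case (step v y x z)
  have x: "\<exists>!y. (y, x) \<in> E"
    using branch_path_endpoint[OF step.prems] by blast
  have y: "y \<notin> A"
    using branch_path_endpoint[OF step.hyps(1) step.prems(2)] by blast
  from step.prems(1) show ?case
  proof cases
    case (step y' z')
    then have "y' = y" using x \<open>(y, x) \<in> E\<close> by blast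
    then show ?thesis using step(1) \<open>branch_free E A\<close> \<open>\<And>w. branch_path E A w y \<Longrightarrow> _ \<Longrightarrow> v = w\<close>
      by blast
  qed (use x y step.hyps in blast)
qed

text \<open>A branching endpoint allows one more arc, and finiteness with acyclicity stops the
  extension. An endpoint that does not branch is linear, its in-neighbour being unique by
  \<open>branch_path_endpoint\<close>.\<close>

lemma branch_path_extends_to_linear:
  assumes "finite E" "acyclic E" "branch_free E A" "Range E - A \<subseteq> Domain E"
    and "branch_path E A v y"
  shows "\<exists>z \<in> linear_points E. branch_path E A v z"
proof -
  have "wf (E\<inverse>)" using assms(1,2) by (rule finite_acyclic_wf_converse)
  then show ?thesis using assms(5)
  proof (induction y)
    case (less y)
    have y: "y \<notin> A" "\<exists>!u. (u, y) \<in> E"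
      using branch_path_endpoint[OF less.prems assms(3)] by auto
    \<comment> \<open>As \<open>y\<close> is in \<open>Range E\<close> and outside \<open>A\<close>,
      it has an out-neighbour.\<close>
    then obtain x where x: "(y, x) \<in> E" using assms(4) by blast
    show ?case
    proof (cases "\<exists>z. z \<noteq> x \<and> (y, z) \<in> E")
      case True
      then have "branch_path E A v x" using less.prems x by (blast intro: branch_path.step)
      then show ?thesis using less.IH x by blast
    next
      case False
      then have "y \<in> linear_points E" using x y(2) unfolding linear_points_def mem_Collect_eq by metis
      then show ?thesis using less.prems by blast
    qed
  qed
qed

text \<open>Choosing a linear endpoint for every start is injective, because the endpoint determines
  the start.\<close>

lemma card_branching_le_card_linear_points:
  assumes "finite E" "acyclic E" "branch_free E A" "Range E - A \<subseteq> Domain E"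
  shows "card (A \<inter> Domain E) \<le> card (linear_points E)"
proof -
  have "\<exists>z. z \<in> linear_points E \<and> branch_path E A v z" if "v \<in> A \<inter> Domain E" for v
    using that branch_path_extends_to_linear[OF assms] by (blast intro: branch_path.start)
  then obtain f where f: "\<And>v. v \<in> A \<inter> Domain E \<Longrightarrow> f v \<in> linear_points E \<and> branch_path E A v (f v)"
    by metis
  have "inj_on f (A \<inter> Domain E)"
    using f branch_path_start_unique[OF _ _ assms(3)] by (intro inj_onI) metis
  moreover have "linear_points E \<subseteq> Domain E" unfolding linear_points_def by blast
  then have "finite (linear_points E)" using assms(1) finite_Domain finite_subset by blast
  ultimately show ?thesis using f by (intro card_inj_on_le[of f]) auto
qed

section \<open>Deleting arcs and contracting strong components\<close>

lemma del_arcs_simps [simp]: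
  "verts (del_arcs G A) = verts G" "arcs (del_arcs G A) = arcs G - A"
  "tail (del_arcs G A) = tail G" "head (del_arcs G A) = head G"
  by (simp_all add: del_arcs_def)

lemma wf_digraph_del_arcs: "wf_digraph G \<Longrightarrow> wf_digraph (del_arcs G A)"
  by (auto simp: wf_digraph_def)

lemma fin_digraph_del_arcs: "fin_digraph G \<Longrightarrow> fin_digraph (del_arcs G A)"
  by (auto simp: fin_digraph_def fin_digraph_axioms_def wf_digraph_del_arcs)

lemma subgraph_del_arcs: "wf_digraph G \<Longrightarrow> subgraph (del_arcs G A) G"
  by (auto simp: subgraph_def compatible_def wf_digraph_del_arcs)

lemma arc_imp_reachable: "wf_digraph G \<Longrightarrow> e \<in> arcs G \<Longrightarrow> tail G e \<rightarrow>\<^sup>*\<^bsub>G\<^esub> head G e"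
  by (intro wf_digraph.reachable_adjI wf_digraph.in_arcs_imp_in_arcs_ends)

lemma dominates_arcE:
  assumes "u \<rightarrow>\<^bsub>G\<^esub> v"
  obtains e where "e \<in> arcs G" "tail G e = u" "head G e = v"
  using assms by (auto simp: arcs_ends_def arc_to_ends_def)

text \<open>The second alternative records only that the walk passes through \<open>e\<close>. In
  the applications it is refuted because it would give a walk back between distinct strong
  components.\<close>

lemma reachable_del_arc_cases:
  assumes "wf_digraph G" "x \<rightarrow>\<^sup>*\<^bsub>G\<^esub> y"
  shows "x \<rightarrow>\<^sup>*\<^bsub>del_arcs G {e}\<^esub> y \<or> x \<rightarrow>\<^sup>*\<^bsub>G\<^esub> tail G e \<and> head G e \<rightarrow>\<^sup>*\<^bsub>G\<^esub> y"
proof -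
  interpret wf_digraph G by fact
  interpret K: wf_digraph "del_arcs G {e}" by (intro wf_digraph_del_arcs) fact
  show ?thesis using assms(2)
  proof (induction rule: converse_reachable_induct)
    case base
    then show ?case by simp
  next
    case (step x z)
    obtain f where f: "f \<in> arcs G" "tail G f = x" "head G f = z"
      using step.hyps(1) by (rule dominates_arcE)
    show ?case
    proof (cases "f = e")
      case True
      then show ?thesis using step.hyps f wellformed(1) by auto
    next
      case False
      then have "x \<rightarrow>\<^sup>*\<^bsub>del_arcs G {e}\<^esub> z" using arc_imp_reachable[OF K.wf_digraph_axioms, of f] f by simp
      then show ?thesis
        using step.IH step.hyps(1) K.reachable_trans adj_reachable_trans by blast
    qed
  qed
qed

text \<open>A walk avoiding \<open>e\<close> shortens to a path, as the definition demands, and this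
  remains a path in \<open>G\<close>.\<close>

lemma transitive_arc_if_reachable:
  assumes "wf_digraph G" "e \<in> arcs G" "tail G e \<rightarrow>\<^sup>*\<^bsub>del_arcs G {e}\<^esub> head G e"
  shows "transitive_arc G e"
proof -
  interpret wf_digraph G by fact
  interpret K: wf_digraph "del_arcs G {e}" by (intro wf_digraph_del_arcs) fact
  have sub: "subgraph (del_arcs G {e}) G"
    using assms(1) by (rule subgraph_del_arcs)
  obtain p where p: "K.apath (tail G e) p (head G e)" using assms(3) K.reachable_apath by blast
  then have "e \<notin> set p" by (auto simp: K.apath_def K.awalk_def)
  then show ?thesis
    using assms(2) subgraph_apath_imp_apath[OF p sub] unfolding transitive_arc_def by blast
qed

section \<open>Strong components and their contraction\<close>

context wf_digraph
begin

lemma sccs_reachable: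
  assumes "S \<in> sccs" "u \<in> verts S" "v \<in> verts S"
  shows "u \<rightarrow>\<^sup>* v"
  using in_sccs_vertsI_sccs[of "verts S"] assms unfolding in_sccs_verts_conv_reachable by blast

text \<open>Maximality puts \<open>v\<close> into \<open>S\<close>; distinct components have
  disjoint vertex sets, and a component is determined by its vertex set.\<close>

lemma sccs_eqI:
  assumes "S \<in> sccs" "T \<in> sccs" "u \<in> verts S" "v \<in> verts T" "u \<rightarrow>\<^sup>* v" "v \<rightarrow>\<^sup>* u"
  shows "S = T"
proof -
  have "verts S \<in> sccs_verts" "verts T \<in> sccs_verts" using assms in_sccs_vertsI_sccs by auto
  moreover have "v \<in> verts S" using calculation(1) assms unfolding in_sccs_verts_conv_reachable by blast
  ultimately have "verts S = verts T" using sccs_verts_disjoint assms(4) by blast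
  then show ?thesis using inj_on_verts_sccs assms by (auto dest: inj_onD)
qed

lemma sccs_verts_nonempty: "S \<in> sccs \<Longrightarrow> verts S \<noteq> {}"
  by (auto simp: sccs_def strongly_connected_def)

lemma sccs_verts_subset: "S \<in> sccs \<Longrightarrow> verts S \<subseteq> verts G"
  using in_sccs_vertsI_sccs sccs_verts_subsets by blast

lemma obtain_scc:
  assumes "u \<in> verts G"
  obtains S where "S \<in> sccs" "u \<in> verts S"
  using scc_of_in_sccs_verts[OF assms] in_scc_of_self[OF assms] unfolding sccs_verts_conv by auto

lemma scc_contraction_arc_iff:
  "(S, T) \<in> arcs (scc_contraction G) \<longleftrightarrow> S \<in> sccs \<and> T \<in> sccs \<and> S \<noteq> T \<and>
     (\<exists>e \<in> arcs G. tail G e \<in> verts S \<and> head G e \<in> verts T)"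
  by (simp add: scc_contraction_def)

text \<open>A walk of the contraction may enter and leave a component at different vertices; strong
  connectivity inside the component bridges the gap.\<close>

lemma scc_contraction_rtrancl_reachable:
  assumes "(S, T) \<in> (arcs (scc_contraction G))\<^sup>*" "S \<in> sccs" "u \<in> verts S" "v \<in> verts T"
  shows "u \<rightarrow>\<^sup>* v"
  using assms
proof (induction arbitrary: v)
  case base
  then show ?case by (blast intro: sccs_reachable)
next
  case (step T U)
  then obtain e where e: "e \<in> arcs G" "tail G e \<in> verts T" "head G e \<in> verts U" "U \<in> sccs"
    by (auto simp: scc_contraction_arc_iff)
  then have "u \<rightarrow>\<^sup>* tail G e" using step by blast
  also have "tail G e \<rightarrow>\<^sup>* head G e" using arc_imp_reachable[OF wf_digraph_axioms e(1)] .
  also have "head G e \<rightarrow>\<^sup>* v" using sccs_reachable e step by blast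
  finally show ?case .
qed

text \<open>A closed walk would make vertices of two distinct components mutually reachable, against
  \<open>sccs_eqI\<close>.\<close>

lemma acyclic_scc_contraction: "acyclic (arcs (scc_contraction G))"
proof (rule acyclicI, rule allI, rule notI)
  fix S assume "(S, S) \<in> (arcs (scc_contraction G))\<^sup>+"
  then obtain T where T: "(S, T) \<in> arcs (scc_contraction G)" "(T, S) \<in> (arcs (scc_contraction G))\<^sup>*"
    by (auto dest: tranclD)
  then have ST: "S \<in> sccs" "T \<in> sccs" "S \<noteq> T" by (auto simp: scc_contraction_arc_iff)
  then obtain s t where "s \<in> verts S" "t \<in> verts T" using sccs_verts_nonempty by blast
  then show False
    using sccs_eqI[OF ST(1,2)] scc_contraction_rtrancl_reachable T ST r_into_rtrancl by metis
qed

text \<open>The first arc of the walk that leaves \<open>S\<close> yields the arc of the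
  contraction.\<close>

lemma scc_contraction_out_arc:
  assumes "S \<in> sccs" "u \<in> verts S" "u \<rightarrow>\<^sup>* v" "v \<notin> verts S"
  shows "S \<in> Domain (arcs (scc_contraction G))"
  using assms(3,2,4)
proof (induction rule: converse_reachable_induct)
  case (step x y)
  obtain e where e: "e \<in> arcs G" "tail G e = x" "head G e = y"
    using step.hyps(1) by (rule dominates_arcE)
  show ?case
  proof (cases "y \<in> verts S")
    case False
    have "y \<in> verts G" using e by auto
    then obtain T where "T \<in> sccs" "y \<in> verts T" by (rule obtain_scc)
    then have "(S, T) \<in> arcs (scc_contraction G)"
      using False assms(1) e step.prems(1) by (auto simp: scc_contraction_arc_iff)
    then show ?thesis by blast
  qed (use step.IH step.prems in blast)
qed simp

text \<open>Here the last arc that enters \<open>S\<close> is needed, so the induction runs from the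
  other end of the walk.\<close>

lemma scc_contraction_in_arc:
  assumes "S \<in> sccs" "u \<in> verts S" "v \<rightarrow>\<^sup>* u" "v \<notin> verts S"
  shows "S \<in> Range (arcs (scc_contraction G))"
  using assms(3,2)
proof (induction rule: reachable_induct)
  case (step x y)
  obtain e where e: "e \<in> arcs G" "tail G e = x" "head G e = y"
    using step.hyps(2) by (rule dominates_arcE)
  show ?case
  proof (cases "x \<in> verts S")
    case False
    have "x \<in> verts G" using e by auto
    then obtain T where "T \<in> sccs" "x \<in> verts T" by (rule obtain_scc)
    then have "(T, S) \<in> arcs (scc_contraction G)"
      using False assms(1) e step.prems(1) by (auto simp: scc_contraction_arc_iff)
    then show ?thesis by blast
  qed (use step.IH step.prems in blast)
qed (use assms(4) in simp)

end

section \<open>Finiteness and degrees in the contraction\<close>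

lemma finite_sccs: "fin_digraph G \<Longrightarrow> finite (pre_digraph.sccs G)"
  by (simp add: fin_digraph.finite_sccs_verts fin_digraph_def wf_digraph.sccs_conv_sccs_verts)

lemma finite_arcs_scc_contraction:
  assumes "fin_digraph G" shows "finite (arcs (scc_contraction G))"
  by (rule finite_subset[of _ "pre_digraph.sccs G \<times> pre_digraph.sccs G"])
    (use finite_sccs[OF assms] in \<open>auto simp: scc_contraction_def\<close>)

lemma out_degree_scc_contraction:
  "out_degree (scc_contraction G) S = card {T. (S, T) \<in> arcs (scc_contraction G)}"
proof -
  have "out_arcs (scc_contraction G) S = Pair S ` {T. (S, T) \<in> arcs (scc_contraction G)}"
    by (auto simp: out_arcs_def scc_contraction_def image_iff)
  then show ?thesis by (simp add: out_degree_def card_image inj_on_def)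
qed

lemma in_degree_scc_contraction:
  "in_degree (scc_contraction G) S = card {T. (T, S) \<in> arcs (scc_contraction G)}"
proof -
  have "in_arcs (scc_contraction G) S = (\<lambda>T. (T, S)) ` {T. (T, S) \<in> arcs (scc_contraction G)}"
    by (auto simp: in_arcs_def scc_contraction_def image_iff)
  then show ?thesis by (simp add: in_degree_def card_image inj_on_def)
qed

lemma card_Collect_eq_1_iff: "card {x. P x} = 1 \<longleftrightarrow> (\<exists>!x. P x)"
  unfolding One_nat_def card_1_singleton_iff Ex1_def by auto

text \<open>Without parallel arcs, degree one means a unique neighbour. Points with an arc are
  automatically vertices, so the restriction to \<open>verts\<close> disappears.\<close>

lemma linear_points_scc_contraction:
  "{S \<in> verts (scc_contraction G). linear_vertex (scc_contraction G) S}
     = linear_points (arcs (scc_contraction G))"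
proof -
  have "S \<in> verts (scc_contraction G)" if "(S, T) \<in> arcs (scc_contraction G)" for S T
    using that by (simp add: scc_contraction_def)
  then show ?thesis
    unfolding linear_points_def linear_vertex_def in_degree_scc_contraction
      out_degree_scc_contraction card_Collect_eq_1_iff by blast
qed

section \<open>Removing a cycle from a minimal strong digraph\<close>

lemma cas_del_arcs: "pre_digraph.cas (del_arcs G A) u p v = pre_digraph.cas G u p v"
  by (induction p arbitrary: u) (simp_all add: pre_digraph.cas.simps)

text \<open>As \<open>e\<close> is not on the cycle, the cycle survives as a closed walk: go from
  \<open>a\<close> on to its base point, then from there to \<open>b\<close>.\<close>

lemma cycle_verts_reachable_del_arcs:
  assumes "wf_digraph G" "pre_digraph.cycle G c" "e \<notin> set c"
    and "a \<in> cycle_verts G c" "b \<in> cycle_verts G c"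
  shows "a \<rightarrow>\<^sup>*\<^bsub>del_arcs G {e}\<^esub> b"
proof -
  interpret wf_digraph G by fact
  interpret K: wf_digraph "del_arcs G {e}" by (intro wf_digraph_del_arcs) fact
  obtain u where "awalk u c u" using assms(2) by (auto simp: cycle_def)
  then have w: "K.awalk u c u"
    using assms(3) by (auto simp: awalk_def K.awalk_def cas_del_arcs)
  then have "cycle_verts G c \<subseteq> set (K.awalk_verts u c)"
    by (auto simp: K.set_awalk_verts cycle_verts_def)
  then show ?thesis
    using w assms K.awalk_verts_reachable_from K.awalk_verts_reachable_to K.reachable_trans by blast
qed

locale minimal_strong_cycle =
  fixes D :: "('a,'b) pre_digraph" and c :: "'b awalk"
  assumes minimal: "minimal_strong_digraph D" and cycle: "pre_digraph.cycle D c"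
begin

abbreviation "D' \<equiv> del_arcs D (set c)"
abbreviation "E \<equiv> arcs (scc_contraction D')"

sublocale digraph D
  using minimal by (simp add: minimal_strong_digraph_def)

sublocale D': fin_digraph D'
  by (intro fin_digraph_del_arcs fin_digraph_axioms)

section \<open>Detours to and from the cycle\<close>

lemma reachable_in_D: "u \<in> verts D \<Longrightarrow> v \<in> verts D \<Longrightarrow> u \<rightarrow>\<^sup>*\<^bsub>D\<^esub> v"
  using minimal unfolding minimal_strong_digraph_def strongly_connected_def by blast

lemma cycle_verts_nonempty: "\<exists>a. a \<in> cycle_verts D c"
  using cycle by (cases c) (auto simp: cycle_def cycle_verts_def)

lemma cycle_verts_subset: "cycle_verts D c \<subseteq> verts D"
  using cycle by (auto simp: cycle_def cycle_verts_def awalk_def)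

text \<open>A path can be cut at its first cycle vertex, and up to there it uses no arc of the cycle.\<close>

lemma reaches_cycle:
  assumes "u \<in> verts D"
  shows "\<exists>a \<in> cycle_verts D c. u \<rightarrow>\<^sup>*\<^bsub>D'\<^esub> a"
proof -
  obtain b where b: "b \<in> cycle_verts D c" using cycle_verts_nonempty by blast
  then have "u \<rightarrow>\<^sup>*\<^bsub>D\<^esub> b" using assms cycle_verts_subset reachable_in_D by blast
  then show ?thesis
  proof (induction rule: converse_reachable_induct)
    case base
    then show ?case using b by (intro bexI[of _ b]) auto
  next
    case (step x y)
    obtain e where e: "e \<in> arcs D" "tail D e = x" "head D e = y"
      using step.hyps(1) by (rule dominates_arcE)
    show ?case
    proof (cases "e \<in> set c")
      case True
      then show ?thesis using e by (auto simp: cycle_verts_def intro!: bexI[of _ x])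
    next
      case False
      then have "x \<rightarrow>\<^sup>*\<^bsub>D'\<^esub> y" using arc_imp_reachable[OF D'.wf_digraph_axioms, of e] e by simp
      then show ?thesis using step.IH D'.reachable_trans by blast
    qed
  qed
qed

text \<open>Dually, only the piece behind the last arc of the cycle is kept.\<close>

lemma reached_from_cycle:
  assumes "u \<in> verts D"
  shows "\<exists>a \<in> cycle_verts D c. a \<rightarrow>\<^sup>*\<^bsub>D'\<^esub> u"
proof -
  obtain b where b: "b \<in> cycle_verts D c" using cycle_verts_nonempty by blast
  then have "b \<rightarrow>\<^sup>*\<^bsub>D\<^esub> u" using assms cycle_verts_subset reachable_in_D by blast
  then show ?thesis
  proof (induction rule: reachable_induct)
    case base
    then show ?case using b by (intro bexI[of _ b]) auto
  next
    case (step x y)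
    obtain e where e: "e \<in> arcs D" "tail D e = x" "head D e = y"
      using step.hyps(2) by (rule dominates_arcE)
    show ?case
    proof (cases "e \<in> set c")
      case True
      then show ?thesis using e by (auto simp: cycle_verts_def intro!: bexI[of _ y])
    next
      case False
      then have "x \<rightarrow>\<^sup>*\<^bsub>D'\<^esub> y" using arc_imp_reachable[OF D'.wf_digraph_axioms, of e] e by simp
      then show ?thesis using step.IH D'.reachable_trans by blast
    qed
  qed
qed

text \<open>If \<open>S\<close> is anchored, the detour stays in \<open>S\<close>. Otherwise it runs
  inside \<open>S\<close> to the tail of a second outgoing arc \<open>f\<close>, crosses
  \<open>f\<close>, and continues to the cycle.\<close>

lemma branching_tail_reaches_cycle:
  assumes "S \<in> D'.sccs" "T \<in> D'.sccs" "S \<noteq> T"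
    and e: "e \<in> arcs D'" "tail D e \<in> verts S" "head D e \<in> verts T"
    and br: "anchored D c S \<or> (\<exists>U. U \<noteq> T \<and> (S, U) \<in> E)"
  shows "\<exists>a \<in> cycle_verts D c. tail D e \<rightarrow>\<^sup>*\<^bsub>del_arcs D' {e}\<^esub> a"
proof -
  interpret K: wf_digraph "del_arcs D' {e}" by (intro wf_digraph_del_arcs D'.wf_digraph_axioms)
  have e_reach: "tail D e \<rightarrow>\<^sup>*\<^bsub>D'\<^esub> head D e"
    using arc_imp_reachable[OF D'.wf_digraph_axioms e(1)] by simp
  have no_return: "\<not> head D e \<rightarrow>\<^sup>*\<^bsub>D'\<^esub> tail D e"
    using D'.sccs_eqI[OF assms(1,2) e(2,3)] e_reach \<open>S \<noteq> T\<close> by blast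
  \<comment> \<open>A walk between vertices of \<open>S\<close> cannot use \<open>e\<close>, as
    nothing leads from the head of \<open>e\<close> back to \<open>S\<close>.\<close>
  have inside: "tail D e \<rightarrow>\<^sup>*\<^bsub>del_arcs D' {e}\<^esub> a" if "a \<in> verts S" for a
  proof -
    have "tail D e \<rightarrow>\<^sup>*\<^bsub>D'\<^esub> a" "a \<rightarrow>\<^sup>*\<^bsub>D'\<^esub> tail D e"
      using that assms D'.sccs_reachable by blast+
    moreover from this have "\<not> head D e \<rightarrow>\<^sup>*\<^bsub>D'\<^esub> a"
      using no_return D'.reachable_trans by blast
    ultimately show ?thesis
      using reachable_del_arc_cases[OF D'.wf_digraph_axioms, of "tail D e" a e] by simp
  qed
  from br show ?thesis
  proof
    assume "anchored D c S"
    then show ?thesis using inside by (auto simp: anchored_def)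
  next
    assume "\<exists>U. U \<noteq> T \<and> (S, U) \<in> E"
    then obtain U f where U: "U \<noteq> T" "U \<in> D'.sccs" "S \<noteq> U"
      and f: "f \<in> arcs D'" "tail D f \<in> verts S" "head D f \<in> verts U"
      by (auto simp: D'.scc_contraction_arc_iff)
    have "f \<noteq> e"
      using D'.sccs_eqI[OF U(2) assms(2) f(3) e(3)] U(1) f(3) D'.sccs_verts_subset[OF U(2)] by auto
    then have f_reach: "tail D f \<rightarrow>\<^sup>*\<^bsub>del_arcs D' {e}\<^esub> head D f"
      using arc_imp_reachable[OF K.wf_digraph_axioms, of f] f by simp
    obtain a where a: "a \<in> cycle_verts D c" "head D f \<rightarrow>\<^sup>*\<^bsub>D'\<^esub> a"
      using reaches_cycle[of "head D f"] f(1) by auto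
    \<comment> \<open>Otherwise \<open>S\<close> and \<open>U\<close> would be mutually reachable
      and coincide. Hence the walk from the head of \<open>f\<close> to the cycle avoids
      \<open>e\<close>.\<close>
    have "\<not> head D f \<rightarrow>\<^sup>*\<^bsub>D'\<^esub> tail D e"
    proof
      assume "head D f \<rightarrow>\<^sup>*\<^bsub>D'\<^esub> tail D e"
      then have "head D f \<rightarrow>\<^sup>*\<^bsub>D'\<^esub> tail D f"
        using D'.sccs_reachable[OF assms(1) e(2) f(2)] D'.reachable_trans by blast
      then show False
        using D'.sccs_eqI[OF assms(1) U(2) f(2,3)] U(3)
          arc_imp_reachable[OF D'.wf_digraph_axioms f(1)] by simp
    qed
    then have "head D f \<rightarrow>\<^sup>*\<^bsub>del_arcs D' {e}\<^esub> a"
      using reachable_del_arc_cases[OF D'.wf_digraph_axioms a(2), of e] by simp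
    then show ?thesis using a(1) inside[OF f(2)] f_reach K.reachable_trans by blast
  qed
qed

text \<open>The mirror image: the detour comes from the cycle, enters \<open>T\<close> by a second
  arc \<open>f\<close> if \<open>T\<close> is not anchored, and ends inside
  \<open>T\<close>.\<close>

lemma branching_head_reached_from_cycle:
  assumes "S \<in> D'.sccs" "T \<in> D'.sccs" "S \<noteq> T"
    and e: "e \<in> arcs D'" "tail D e \<in> verts S" "head D e \<in> verts T"
    and br: "anchored D c T \<or> (\<exists>U. U \<noteq> S \<and> (U, T) \<in> E)"
  shows "\<exists>a \<in> cycle_verts D c. a \<rightarrow>\<^sup>*\<^bsub>del_arcs D' {e}\<^esub> head D e"
proof -
  interpret K: wf_digraph "del_arcs D' {e}" by (intro wf_digraph_del_arcs D'.wf_digraph_axioms)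
  have e_reach: "tail D e \<rightarrow>\<^sup>*\<^bsub>D'\<^esub> head D e"
    using arc_imp_reachable[OF D'.wf_digraph_axioms e(1)] by simp
  have no_return: "\<not> head D e \<rightarrow>\<^sup>*\<^bsub>D'\<^esub> tail D e"
    using D'.sccs_eqI[OF assms(1,2) e(2,3)] e_reach \<open>S \<noteq> T\<close> by blast
  have inside: "a \<rightarrow>\<^sup>*\<^bsub>del_arcs D' {e}\<^esub> head D e" if "a \<in> verts T" for a
  proof -
    have "head D e \<rightarrow>\<^sup>*\<^bsub>D'\<^esub> a" "a \<rightarrow>\<^sup>*\<^bsub>D'\<^esub> head D e"
      using that assms D'.sccs_reachable by blast+
    moreover from this have "\<not> a \<rightarrow>\<^sup>*\<^bsub>D'\<^esub> tail D e"
      using no_return D'.reachable_trans by blast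
    ultimately show ?thesis
      using reachable_del_arc_cases[OF D'.wf_digraph_axioms, of a "head D e" e] by simp
  qed
  from br show ?thesis
  proof
    assume "anchored D c T"
    then show ?thesis using inside by (auto simp: anchored_def)
  next
    assume "\<exists>U. U \<noteq> S \<and> (U, T) \<in> E"
    then obtain U f where U: "U \<noteq> S" "U \<in> D'.sccs" "U \<noteq> T"
      and f: "f \<in> arcs D'" "tail D f \<in> verts U" "head D f \<in> verts T"
      by (auto simp: D'.scc_contraction_arc_iff)
    have "f \<noteq> e"
      using D'.sccs_eqI[OF U(2) assms(1) f(2) e(2)] U(1) f(2) D'.sccs_verts_subset[OF U(2)] by auto
    then have f_reach: "tail D f \<rightarrow>\<^sup>*\<^bsub>del_arcs D' {e}\<^esub> head D f"
      using arc_imp_reachable[OF K.wf_digraph_axioms, of f] f by simp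
    obtain a where a: "a \<in> cycle_verts D c" "a \<rightarrow>\<^sup>*\<^bsub>D'\<^esub> tail D f"
      using reached_from_cycle[of "tail D f"] f(1) by auto
    have "\<not> head D e \<rightarrow>\<^sup>*\<^bsub>D'\<^esub> tail D f"
    proof
      assume "head D e \<rightarrow>\<^sup>*\<^bsub>D'\<^esub> tail D f"
      then have "head D f \<rightarrow>\<^sup>*\<^bsub>D'\<^esub> tail D f"
        using D'.sccs_reachable[OF assms(2) f(3) e(3)] D'.reachable_trans by blast
      then show False
        using D'.sccs_eqI[OF U(2) assms(2) f(2,3)] U(3)
          arc_imp_reachable[OF D'.wf_digraph_axioms f(1)] by simp
    qed
    then have "a \<rightarrow>\<^sup>*\<^bsub>del_arcs D' {e}\<^esub> tail D f"
      using reachable_del_arc_cases[OF D'.wf_digraph_axioms a(2), of e] by simp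
    then show ?thesis using a(1) inside[OF f(3)] f_reach K.reachable_trans by blast
  qed
qed

lemma branch_free_anchored: "branch_free E (Collect (anchored D c))"
  unfolding branch_free_def mem_Collect_eq
proof (intro allI impI notI, elim conjE)
  fix S T
  assume ST: "(S, T) \<in> E"
    and out: "anchored D c S \<or> (\<exists>U. U \<noteq> T \<and> (S, U) \<in> E)"
    and "in": "anchored D c T \<or> (\<exists>U. U \<noteq> S \<and> (U, T) \<in> E)"
  then obtain e where e: "S \<in> D'.sccs" "T \<in> D'.sccs" "S \<noteq> T"
      "e \<in> arcs D'" "tail D e \<in> verts S" "head D e \<in> verts T"
    by (auto simp: D'.scc_contraction_arc_iff)
  interpret K: wf_digraph "del_arcs D {e}" by (intro wf_digraph_del_arcs wf_digraph_axioms)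
  \<comment> \<open>Both detours live in \<open>D'\<close> without \<open>e\<close>; joining them
    along the cycle takes place in the larger \<open>del_arcs D {e}\<close>.\<close>
  have sub: "subgraph (del_arcs D' {e}) (del_arcs D {e})"
    by (auto simp: subgraph_def compatible_def wf_digraph_del_arcs D'.wf_digraph_axioms
        wf_digraph_axioms)
  obtain a b where ab: "a \<in> cycle_verts D c" "tail D e \<rightarrow>\<^sup>*\<^bsub>del_arcs D {e}\<^esub> a"
      "b \<in> cycle_verts D c" "b \<rightarrow>\<^sup>*\<^bsub>del_arcs D {e}\<^esub> head D e"
    using branching_tail_reaches_cycle[OF e out] branching_head_reached_from_cycle[OF e "in"]
      pre_digraph.reachable_mono[OF _ sub] by blast
  moreover have "a \<rightarrow>\<^sup>*\<^bsub>del_arcs D {e}\<^esub> b"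
    using cycle_verts_reachable_del_arcs[OF wf_digraph_axioms cycle _ ab(1,3)] e(4) by simp
  ultimately have "tail D e \<rightarrow>\<^sup>*\<^bsub>del_arcs D {e}\<^esub> head D e"
    using K.reachable_trans by blast
  then have "transitive_arc D e"
    using e(4) by (intro transitive_arc_if_reachable wf_digraph_axioms) simp_all
  then show False using minimal e(4) by (auto simp: minimal_strong_digraph_def)
qed

text \<open>Such a component contains no cycle vertex, so the walks of \<open>D'\<close> to and from
  the cycle must cross its boundary.\<close>

lemma not_anchored_in_Domain_Range:
  assumes "S \<in> D'.sccs" "\<not> anchored D c S"
  shows "S \<in> Domain E" "S \<in> Range E"
proof -
  obtain u where u: "u \<in> verts S" "u \<in> verts D"
    using D'.sccs_verts_nonempty[OF assms(1)] D'.sccs_verts_subset[OF assms(1)] by auto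
  have "a \<notin> verts S" if "a \<in> cycle_verts D c" for a
    using assms that by (auto simp: anchored_def)
  then show "S \<in> Domain E" "S \<in> Range E"
    using D'.scc_contraction_out_arc[OF assms(1) u(1)] D'.scc_contraction_in_arc[OF assms(1) u(1)]
      reaches_cycle[OF u(2)] reached_from_cycle[OF u(2)] by blast+
qed

section \<open>Counting pseudominimal and pseudomaximal vertices\<close>

lemma sccs_if_Field: "S \<in> Field E \<Longrightarrow> S \<in> D'.sccs"
  by (auto simp: Field_def D'.scc_contraction_arc_iff)

lemma finite_E: "finite E"
  by (intro finite_arcs_scc_contraction D'.fin_digraph_axioms)

lemma card_anchored_Domain_le: "card (Collect (anchored D c) \<inter> Domain E) \<le> card (linear_points E)"
proof (intro card_branching_le_card_linear_points finite_E D'.acyclic_scc_contraction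
    branch_free_anchored subsetI)
  fix S assume "S \<in> Range E - Collect (anchored D c)"
  then show "S \<in> Domain E"
    using not_anchored_in_Domain_Range(1) sccs_if_Field by (auto simp: Field_def)
qed

text \<open>Reversal exchanges \<open>Domain\<close> and \<open>Range\<close> and keeps the linear
  points, so the counting lemma is applied to the converse of \<open>E\<close>.\<close>

lemma card_anchored_Range_le: "card (Collect (anchored D c) \<inter> Range E) \<le> card (linear_points E)"
proof -
  have "Range (E\<inverse>) - Collect (anchored D c) \<subseteq> Domain (E\<inverse>)"
    using not_anchored_in_Domain_Range(2) sccs_if_Field by (auto simp: Field_def)
  then show ?thesis
    using card_branching_le_card_linear_points[of "E\<inverse>" "Collect (anchored D c)"] finite_E
      D'.acyclic_scc_contraction branch_free_converse[OF branch_free_anchored]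
    by (simp add: linear_points_converse)
qed

lemma pseudominimal_eq:
  "{S \<in> verts (hasse_diagram D c). pseudominimal D c S} = Collect (anchored D c) \<inter> Domain E"
proof -
  \<comment> \<open>Infinite sets have \<open>card\<close> 0, so positive degree matches a nonempty
    set of out-neighbours only once finiteness is known.\<close>
  have "finite {T. (S, T) \<in> E}" for S
    using finite_E by (rule finite_subset[OF _ finite_Range, rotated]) blast
  then have "card {T. (S, T) \<in> E} > 0 \<longleftrightarrow> S \<in> Domain E" for S
    by (auto simp: card_gt_0_iff)
  moreover have "verts (scc_contraction D') = D'.sccs" by (simp add: scc_contraction_def)
  ultimately show ?thesis
    unfolding pseudominimal_def hasse_diagram_def out_degree_scc_contraction
    by (auto simp: anchored_def)
qed

lemma pseudomaximal_eq:
  "{S \<in> verts (hasse_diagram D c). pseudomaximal D c S} = Collect (anchored D c) \<inter> Range E"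
proof -
  have "finite {T. (T, S) \<in> E}" for S
    using finite_E by (rule finite_subset[OF _ finite_Domain, rotated]) blast
  then have "card {T. (T, S) \<in> E} > 0 \<longleftrightarrow> S \<in> Range E" for S
    by (auto simp: card_gt_0_iff)
  moreover have "verts (scc_contraction D') = D'.sccs" by (simp add: scc_contraction_def)
  ultimately show ?thesis
    unfolding pseudomaximal_def hasse_diagram_def in_degree_scc_contraction
    by (auto simp: anchored_def)
qed

end

theorem theorem2:
  fixes D :: "('a,'b) pre_digraph" and c :: "'b awalk" and q :: nat
  defines "H \<equiv> hasse_diagram D c"
  assumes "minimal_strong_digraph D"
    and "pre_digraph.cycle D c" and "length c = q" and "q \<ge> 2"
  shows "card {S \<in> verts H. pseudominimal D c S} \<le> card {S \<in> verts H. linear_vertex H S} \<and>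
         card {S \<in> verts H. pseudomaximal D c S} \<le> card {S \<in> verts H. linear_vertex H S}"
proof -
  interpret minimal_strong_cycle D c using assms(2,3) by unfold_locales
  show ?thesis
    unfolding H_def pseudominimal_eq pseudomaximal_eq
    unfolding hasse_diagram_def linear_points_scc_contraction
    using card_anchored_Domain_le card_anchored_Range_le by blast
qed

end
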